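(* The stranded conductor model $$M_\sigma\tfrac{\mathrm d}{\mathrm dt}a+K_\nu a-X_{\mathrm{str}}\,\imath_{\mathrm{str}}=0,\qquad X_{\mathrm{str}}^\top\tfrac{\mathrm d}{\mathrm dt}a+R_{\mathrm{str}}\,\imath_{\mathrm{str}}-v_{\mathrm{str}}=0,$$ with unknowns $a\colon[t_0,t_{\mathrm f}]\to\mathbb R^{n_w}$ and $\imath_{\mathrm{str}}\colon[t_0,t_{\mathrm f}]\to\mathbb R^{n_{\mathrm{str}}}$ and input $v_{\mathrm{str}}\colon[t_0,t_{\mathrm f}]\to\mathbb R^{n_{\mathrm{str}}}$, fits into the structure $$\begin{bmatrix}\nabla_{z_1}\mathcal H(z_1,z_2)\\ \frac{\mathrm d}{\mathrm dt}z_2\\ 0\end{bmatrix}=(\mathcal J-\mathcal R)\begin{bmatrix}\frac{\mathrm d}{\mathrm dt}z_1\\ \nabla_{z_2}\mathcal H(z_1,z_2)\\ z_3\end{bmatrix}+\mathcal B u$$ with $\mathcal J=-\mathcal J^\top$ and $\mathcal R=\mathcal R^\top$ positive semi-definite.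
   Context: "Fits into the structure" means: the unknowns of the model can be grouped into components $z_1,z_2,z_3$ (any of which may be absent) and, with $u$ the input of the model, there exist a function $\mathcal H\in C^1$ of $(z_1,z_2)$ and real constant matrices $\mathcal J=-\mathcal J^\top$, $\mathcal R=\mathcal R^\top\ge0$, $\mathcal B$ of appropriate sizes such that the model equations are equivalent to the displayed structured system. Matrices of the model. $\Omega\subset\mathbb R^3$ is a simply connected Lipschitz domain; $w_1,\dots,w_{n_w}$ are (vector-valued, edge-element) finite element basis functions on $\Omega$, lying in $H(\mathrm{curl};\Omega)$ with vanishing tangential trace; $\nu>0$ is a constant (reluctivity); the conductivity $\sigma$ equals a constant $\sigma_{\mathrm c}>0$ on a subdomain $\Omega_{\mathrm c}\subset\Omega$ and $0$ elsewhere. Then $$[M_\sigma]_{ij}=\int_\Omega\sigma\,w_j\cdot w_i\,\mathrm dV,\qquad [K_\nu]_{ij}=\int_\Omega\nu\,(\nabla\times w_j)\cdot(\nabla\times w_i)\,\mathrm dV .$$ It is assumed that (after gauging) the pencil $\lambda M_\sigma+K_\nu$ is regular. The stranded conductor domains $\Omega_{\mathrm{str},1},\dots,\Omega_{\mathrm{str},n_{\mathrm{str}}}$ are disjoint subdomains of $\Omega$ with union $\Omega_{\mathrm{str}}$, contained in the region where $\sigma=0$. With winding functions $\chi_{\mathrm{str},k}\colon\Omega_{\mathrm{str},k}\to\mathbb R^3$ (extended by zero), $X_{\mathrm{str}}\in\mathbb R^{n_w\times n_{\mathrm{str}}}$ is given by $[X_{\mathrm{str}}]_{ik}=\int_\Omega\chi_{\mathrm{str},k}\cdot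 w_i\,\mathrm dV$. Finally $R_{\mathrm{str}}=X_{\mathrm{str}}^\top M_{\mathrm{str}}^{+}X_{\mathrm{str}}$, where $M_{\mathrm{str}}^{+}$ is the Moore–Penrose pseudo-inverse of $M_{\mathrm{str}}$, which is defined like $M_\sigma$ but with the conductivity set to a constant $\sigma_{\mathrm{str}}>0$ on $\Omega_{\mathrm{str}}$ (and equal to $\sigma$ elsewhere). *)

theory Defs
  imports "HOL-Analysis.Analysis"
begin

section \<open>Domains\<close>

definition domain_set :: "'a::topological_space set \<Rightarrow> bool" where
  "domain_set S \<longleftrightarrow> open S \<and> connected S \<and> S \<noteq> {}"

definition subdomain :: "'a::topological_space set \<Rightarrow> 'a set \<Rightarrow> bool" where
  "subdomain S \<Omega> \<longleftrightarrow> domain_set S \<and> S \<subseteq> \<Omega>"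

text \<open>Near each boundary point and after an orthogonal change of coordinates, the set is the
  strict epigraph of a Lipschitz function of the first two coordinates. As the neighbourhood
  \<open>V\<close> is open, the boundary is then the graph of that function within \<open>V\<close>.\<close>

definition lipschitz_boundary :: "(real^3) set \<Rightarrow> bool" where
  "lipschitz_boundary \<Omega> \<longleftrightarrow>
     (\<forall>p\<in>frontier \<Omega>. \<exists>V (A :: real^3 \<Rightarrow> real^3) (g :: real^2 \<Rightarrow> real) L.
        open V \<and> p \<in> V \<and> orthogonal_transformation A \<and> L-lipschitz_on UNIV g \<and>
        \<Omega> \<inter> V = {x\<in>V. g (vector [A x $ 1, A x $ 2]) < A x $ 3})"

definition lipschitz_domain :: "(real^3) set \<Rightarrow> bool" where
  "lipschitz_domain \<Omega> \<longleftrightarrow> domain_set \<Omega> \<and> lipschitz_boundary \<Omega>"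


section \<open>The space H(curl) and the tangential trace\<close>

primrec Ck :: "nat \<Rightarrow> ('a::euclidean_space \<Rightarrow> 'b::real_normed_vector) \<Rightarrow> bool" where
  "Ck 0 f \<longleftrightarrow> continuous_on UNIV f"
| "Ck (Suc k) f \<longleftrightarrow> f differentiable_on UNIV \<and>
     (\<forall>b\<in>Basis. Ck k (\<lambda>x. frechet_derivative f (at x) b))"

definition smooth_compact_support :: "(real^3 \<Rightarrow> real^3) \<Rightarrow> (real^3) set \<Rightarrow> bool" where
  "smooth_compact_support f S \<longleftrightarrow>
     (\<forall>k. Ck k f) \<and> (\<exists>C. compact C \<and> C \<subseteq> S \<and> (\<forall>x. x \<notin> C \<longrightarrow> f x = 0))"

definition partial_deriv :: "3 \<Rightarrow> (real^3 \<Rightarrow> real^3) \<Rightarrow> real^3 \<Rightarrow> real^3" where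
  "partial_deriv j f x = frechet_derivative f (at x) (axis j 1)"

definition classical_curl :: "(real^3 \<Rightarrow> real^3) \<Rightarrow> real^3 \<Rightarrow> real^3" where
  "classical_curl f x = vector
     [partial_deriv 2 f x $ 3 - partial_deriv 3 f x $ 2,
      partial_deriv 3 f x $ 1 - partial_deriv 1 f x $ 3,
      partial_deriv 1 f x $ 2 - partial_deriv 2 f x $ 1]"

definition square_integrable :: "(real^3) set \<Rightarrow> (real^3 \<Rightarrow> real^3) \<Rightarrow> bool" where
  "square_integrable \<Omega> f \<longleftrightarrow>
     f \<in> borel_measurable (lebesgue_on \<Omega>) \<and>
     integrable (lebesgue_on \<Omega>) (\<lambda>x. (norm (f x))\<^sup>2)"

definition is_weak_curl ::
    "(real^3) set \<Rightarrow> (real^3 \<Rightarrow> real^3) \<Rightarrow> (real^3 \<Rightarrow> real^3) \<Rightarrow> bool" where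
  "is_weak_curl \<Omega> w c \<longleftrightarrow>
     square_integrable \<Omega> c \<and>
     (\<forall>\<phi>. smooth_compact_support \<phi> \<Omega> \<longrightarrow>
        (\<integral>x. w x \<bullet> classical_curl \<phi> x \<partial>lebesgue_on \<Omega>) = (\<integral>x. c x \<bullet> \<phi> x \<partial>lebesgue_on \<Omega>))"

definition Hcurl :: "(real^3) set \<Rightarrow> (real^3 \<Rightarrow> real^3) set" where
  "Hcurl \<Omega> = {w. square_integrable \<Omega> w \<and> (\<exists>c. is_weak_curl \<Omega> w c)}"

text \<open>The weak curl of an element of \<open>Hcurl \<Omega>\<close> is unique up to null sets; a representative is
  chosen. The integrals below do not depend on it.\<close>

definition weak_curl :: "(real^3) set \<Rightarrow> (real^3 \<Rightarrow> real^3) \<Rightarrow> real^3 \<Rightarrow> real^3" where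
  "weak_curl \<Omega> w = (SOME c. is_weak_curl \<Omega> w c)"

text \<open>The tangential trace \<open>n \<times> w\<close> of an element of H(curl) is the functional that Green's formula
  assigns to it on (traces of) smooth fields \<open>\<phi>\<close>, not required to vanish on the boundary:
  the boundary integral of \<open>(n \<times> w) \<cdot> \<phi>\<close> equals the integral of
  \<open>curl w \<cdot> \<phi> - w \<cdot> curl \<phi>\<close> over \<open>\<Omega>\<close>.\<close>

definition tangential_trace ::
    "(real^3) set \<Rightarrow> (real^3 \<Rightarrow> real^3) \<Rightarrow> (real^3 \<Rightarrow> real^3) \<Rightarrow> real" where
  "tangential_trace \<Omega> w \<phi> =
     (\<integral>x. weak_curl \<Omega> w x \<bullet> \<phi> x \<partial>lebesgue_on \<Omega>) -
     (\<integral>x. w x \<bullet> classical_curl \<phi> x \<partial>lebesgue_on \<Omega>)"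

definition vanishing_tangential_trace :: "(real^3) set \<Rightarrow> (real^3 \<Rightarrow> real^3) \<Rightarrow> bool" where
  "vanishing_tangential_trace \<Omega> w \<longleftrightarrow>
     (\<forall>\<phi>. smooth_compact_support \<phi> UNIV \<longrightarrow> tangential_trace \<Omega> w \<phi> = 0)"

definition lin_indep_ae :: "(real^3) set \<Rightarrow> ('w::finite \<Rightarrow> real^3 \<Rightarrow> real^3) \<Rightarrow> bool" where
  "lin_indep_ae \<Omega> w \<longleftrightarrow>
     (\<forall>c :: real^'w. (AE x in lebesgue_on \<Omega>. (\<Sum>i\<in>UNIV. (c $ i) *\<^sub>R w i x) = 0) \<longrightarrow> c = 0)"


section \<open>Matrices\<close>

definition positive_semidefinite :: "real^'n^'n \<Rightarrow> bool" where
  "positive_semidefinite A \<longleftrightarrow> (\<forall>x. 0 \<le> x \<bullet> (A *v x))"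

definition regular_pencil :: "real^'n^'n \<Rightarrow> real^'n^'n \<Rightarrow> bool" where
  "regular_pencil M K \<longleftrightarrow>
     (\<exists>l::complex. det (\<chi> i j. l * of_real (M $ i $ j) + of_real (K $ i $ j)) \<noteq> 0)"

text \<open>The four Penrose conditions.\<close>

definition is_pseudo_inverse :: "real^'n^'m \<Rightarrow> real^'m^'n \<Rightarrow> bool" where
  "is_pseudo_inverse A P \<longleftrightarrow>
     A ** P ** A = A \<and> P ** A ** P = P \<and>
     transpose (A ** P) = A ** P \<and> transpose (P ** A) = P ** A"

definition pseudo_inverse :: "real^'n^'m \<Rightarrow> real^'m^'n" where
  "pseudo_inverse A = (THE P. is_pseudo_inverse A P)"

definition conductivity :: "(real^3) set \<Rightarrow> real \<Rightarrow> real^3 \<Rightarrow> real" where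
  "conductivity \<Omega>c \<sigma>c x = (if x \<in> \<Omega>c then \<sigma>c else 0)"

definition conductivity_str ::
    "(real^3) set \<Rightarrow> real \<Rightarrow> ('s \<Rightarrow> (real^3) set) \<Rightarrow> real \<Rightarrow> real^3 \<Rightarrow> real" where
  "conductivity_str \<Omega>c \<sigma>c \<Omega>str \<sigma>str x =
     (if x \<in> (\<Union>k. \<Omega>str k) then \<sigma>str else conductivity \<Omega>c \<sigma>c x)"

definition mass_matrix ::
    "(real^3) set \<Rightarrow> (real^3 \<Rightarrow> real) \<Rightarrow> ('w::finite \<Rightarrow> real^3 \<Rightarrow> real^3) \<Rightarrow> real^'w^'w" where
  "mass_matrix \<Omega> \<sigma> w = (\<chi> i j. \<integral>x. \<sigma> x * (w j x \<bullet> w i x) \<partial>lebesgue_on \<Omega>)"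

definition curl_curl_matrix ::
    "(real^3) set \<Rightarrow> real \<Rightarrow> ('w::finite \<Rightarrow> real^3 \<Rightarrow> real^3) \<Rightarrow> real^'w^'w" where
  "curl_curl_matrix \<Omega> \<nu> w =
     (\<chi> i j. \<integral>x. \<nu> * (weak_curl \<Omega> (w j) x \<bullet> weak_curl \<Omega> (w i) x) \<partial>lebesgue_on \<Omega>)"

definition zero_extension :: "(real^3) set \<Rightarrow> (real^3 \<Rightarrow> real^3) \<Rightarrow> real^3 \<Rightarrow> real^3" where
  "zero_extension S f x = (if x \<in> S then f x else 0)"

definition winding_matrix ::
    "(real^3) set \<Rightarrow> ('s::finite \<Rightarrow> (real^3) set) \<Rightarrow> ('s \<Rightarrow> real^3 \<Rightarrow> real^3) \<Rightarrow>
     ('w::finite \<Rightarrow> real^3 \<Rightarrow> real^3) \<Rightarrow> real^'s^'w" where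
  "winding_matrix \<Omega> \<Omega>str wind w =
     (\<chi> i k. \<integral>x. zero_extension (\<Omega>str k) (wind k) x \<bullet> w i x \<partial>lebesgue_on \<Omega>)"

definition resistance_matrix :: "real^'s^'w \<Rightarrow> real^'w^'w \<Rightarrow> real^'s^'s" where
  "resistance_matrix X Mstr = transpose X ** pseudo_inverse Mstr ** X"


section \<open>The stranded conductor model\<close>

text \<open>The equations at the time \<open>t\<close> of the interval \<open>T\<close>, with one-sided derivatives at its ends.\<close>

definition stranded_model_at ::
    "real^'w^'w \<Rightarrow> real^'w^'w \<Rightarrow> real^'s^'w \<Rightarrow> real^'s^'s \<Rightarrow> real set \<Rightarrow>
     (real \<Rightarrow> real^'w) \<Rightarrow> (real \<Rightarrow> real^'s) \<Rightarrow> (real \<Rightarrow> real^'s) \<Rightarrow> real \<Rightarrow> bool" where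
  "stranded_model_at M K X R T a istr vstr t \<longleftrightarrow>
     (\<exists>da. (a has_vector_derivative da) (at t within T) \<and>
        M *v da + K *v a t - X *v istr t = 0 \<and>
        transpose X *v da + R *v istr t - vstr t = 0)"


section \<open>The structure\<close>

text \<open>The unknowns of a model are the coordinates of a vector in \<open>real^'n\<close>. A grouping assigns each
  coordinate to one of the components z1, z2, z3; a component is absent if no coordinate is
  assigned to it. Vectors and matrices of the structured system are indexed by the same type
  \<open>'n\<close>, the block of an index being given by the grouping, so no order of the unknowns has to be
  fixed.\<close>

datatype component = Z1 | Z2 | Z3

text \<open>\<open>H\<close> is a C1 function of (z1, z2) with gradient \<open>G\<close>: it is constant in the z3-coordinates.\<close>

definition C1_hamiltonian ::
    "('n::finite \<Rightarrow> component) \<Rightarrow> (real^'n \<Rightarrow> real) \<Rightarrow> (real^'n \<Rightarrow> real^'n) \<Rightarrow> bool" where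
  "C1_hamiltonian grp H G \<longleftrightarrow>
     (\<forall>z z'. (\<forall>i. grp i \<noteq> Z3 \<longrightarrow> z $ i = z' $ i) \<longrightarrow> H z = H z') \<and>
     (\<forall>z. GDERIV H z :> G z) \<and> continuous_on UNIV G"

text \<open>\<open>dz\<close> collects the time derivatives of z1 and z2; z3 need not be differentiable and the
  corresponding entries of \<open>dz\<close> do not occur in the equations.\<close>

definition structured_system_at ::
    "('n::finite \<Rightarrow> component) \<Rightarrow> (real^'n \<Rightarrow> real^'n) \<Rightarrow> real^'n^'n \<Rightarrow> real^'n^'n \<Rightarrow> real^'m^'n \<Rightarrow>
     real set \<Rightarrow> (real \<Rightarrow> real^'n) \<Rightarrow> (real \<Rightarrow> real^'m) \<Rightarrow> real \<Rightarrow> bool" where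
  "structured_system_at grp G J R B T z u t \<longleftrightarrow>
     (\<exists>dz :: real^'n.
        (\<forall>i. grp i \<noteq> Z3 \<longrightarrow> ((\<lambda>s. z s $ i) has_real_derivative dz $ i) (at t within T)) \<and>
        (\<chi> i. case grp i of Z1 \<Rightarrow> G (z t) $ i | Z2 \<Rightarrow> dz $ i | Z3 \<Rightarrow> 0) =
          (J - R) *v (\<chi> i. case grp i of Z1 \<Rightarrow> dz $ i | Z2 \<Rightarrow> G (z t) $ i | Z3 \<Rightarrow> z t $ i)
          + B *v u t)"

text \<open>A model is given by the predicate telling whether its equations hold for a trajectory of the
  unknowns and an input at a time. Equivalence of the equations is required at every time.\<close>

definition fits_structure ::
    "real set \<Rightarrow> ((real \<Rightarrow> real^'n::finite) \<Rightarrow> (real \<Rightarrow> real^'m) \<Rightarrow> real \<Rightarrow> bool) \<Rightarrow> bool" where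
  "fits_structure T model \<longleftrightarrow>
     (\<exists>(grp :: 'n \<Rightarrow> component) H G (J :: real^'n^'n) (R :: real^'n^'n) (B :: real^'m^'n).
        C1_hamiltonian grp H G \<and>
        J = - transpose J \<and> R = transpose R \<and> positive_semidefinite R \<and>
        (\<forall>z u. \<forall>t\<in>T. model z u t \<longleftrightarrow> structured_system_at grp G J R B T z u t))"

definition inl_part :: "real^('w::finite + 's::finite) \<Rightarrow> real^'w" where
  "inl_part z = (\<chi> i. z $ Inl i)"

definition inr_part :: "real^('w::finite + 's::finite) \<Rightarrow> real^'s" where
  "inr_part z = (\<chi> k. z $ Inr k)"

end

theory Submission
  imports Defs
begin

text \<open>Take \<open>z1 = a\<close>, \<open>z3 = i_str\<close>, no \<open>z2\<close>, and \<open>H(a) = (a \<bullet> K a) / 2\<close>. The model then reads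
  \<open>K a = - M a' + X i_str\<close> and \<open>0 = - X\<^sup>T a' - R i_str + v_str\<close>, so the skew part carries the coupling
  by \<open>X\<close> and the dissipative part is the block diagonal matrix of \<open>M\<close> and \<open>R\<close>. Mass matrices are
  positive semi-definite, and \<open>P = P A P\<close> transfers this from a symmetric \<open>A\<close> to its
  pseudo-inverse \<open>P\<close>. With \<open>Q\<close> the orthogonal projection onto the kernel of \<open>A\<close>, that
  pseudo-inverse is the inverse of \<open>A + Q\<close> minus \<open>Q\<close>.\<close>

subsection \<open>Positive semi-definiteness of the matrices of the model\<close>

text \<open>Cauchy-Schwarz and \<open>2 * a * b \<le> a^2 + b^2\<close> dominate the integrand by a
  multiple of two integrable squares.\<close>

lemma square_integrable_inner:
  assumes \<sigma>: "\<sigma> \<in> borel_measurable (lebesgue_on S)" and bd: "\<And>x. \<bar>\<sigma> x\<bar> \<le> C"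
    and f: "square_integrable S f" and g: "square_integrable S g"
  shows "integrable (lebesgue_on S) (\<lambda>x. \<sigma> x * (f x \<bullet> g x))"
proof (rule Bochner_Integration.integrable_bound)
  have [measurable]: "f \<in> borel_measurable (lebesgue_on S)" "g \<in> borel_measurable (lebesgue_on S)"
    "\<sigma> \<in> borel_measurable (lebesgue_on S)"
    using f g \<sigma> by (auto simp: square_integrable_def)
  show "integrable (lebesgue_on S) (\<lambda>x. C * ((norm (f x))\<^sup>2 + (norm (g x))\<^sup>2))"
    using f g by (intro integrable_mult_right Bochner_Integration.integrable_add)
      (auto simp: square_integrable_def)
  show "(\<lambda>x. \<sigma> x * (f x \<bullet> g x)) \<in> borel_measurable (lebesgue_on S)"
    by measurable
  have "\<bar>\<sigma> x * (f x \<bullet> g x)\<bar> \<le> C * ((norm (f x))\<^sup>2 + (norm (g x))\<^sup>2)" for x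
  proof -
    have "2 * (norm (f x) * norm (g x)) \<le> (norm (f x))\<^sup>2 + (norm (g x))\<^sup>2"
      using sum_squares_bound[of "norm (f x)" "norm (g x)"] by simp
    moreover have "\<bar>f x \<bullet> g x\<bar> \<le> norm (f x) * norm (g x)"
      by (rule Cauchy_Schwarz_ineq2)
    moreover have "0 \<le> norm (f x) * norm (g x)" by simp
    ultimately have "\<bar>f x \<bullet> g x\<bar> \<le> (norm (f x))\<^sup>2 + (norm (g x))\<^sup>2" by linarith
    then show ?thesis
      unfolding abs_mult using bd[of x] by (intro mult_mono) auto
  qed
  then show "AE x in lebesgue_on S. norm (\<sigma> x * (f x \<bullet> g x))
      \<le> norm (C * ((norm (f x))\<^sup>2 + (norm (g x))\<^sup>2))"
    by (intro AE_I2) (metis abs_ge_self order_trans real_norm_def)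
qed

text \<open>The quadratic form at \<open>c\<close> is the integral of \<open>\<sigma>\<close> times
  the squared norm of the field \<open>\<Sum>i. c $ i *\<^sub>R w i\<close>. The bound
  \<open>C\<close> makes all entries integrable, so that the finite sums may be moved under the
  integral.\<close>

lemma mass_matrix_positive_semidefinite:
  assumes \<sigma>: "\<sigma> \<in> borel_measurable (lebesgue_on S)" and nn: "\<And>x. 0 \<le> \<sigma> x" and bd: "\<And>x. \<sigma> x \<le> C"
    and w: "\<And>i. square_integrable S (w i)"
  shows "positive_semidefinite (mass_matrix S \<sigma> w)"
  unfolding positive_semidefinite_def
proof
  fix c :: "real^'a"
  have int: "integrable (lebesgue_on S) (\<lambda>x. \<sigma> x * (w j x \<bullet> w i x))" for i j
    using nn bd by (intro square_integrable_inner[OF \<sigma> _ w w, of C]) auto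
  have "c \<bullet> (mass_matrix S \<sigma> w *v c) =
      (\<Sum>i\<in>UNIV. \<Sum>j\<in>UNIV. (c $ i * c $ j) * (\<integral>x. \<sigma> x * (w j x \<bullet> w i x) \<partial>lebesgue_on S))"
    by (simp add: inner_vec_def matrix_vector_mult_def mass_matrix_def sum_distrib_left mult_ac)
  also have "\<dots> = (\<integral>x. (\<Sum>i\<in>UNIV. \<Sum>j\<in>UNIV. (c $ i * c $ j) * (\<sigma> x * (w j x \<bullet> w i x))) \<partial>lebesgue_on S)"
    by (simp add: int Bochner_Integration.integral_sum)
  also have "\<dots> = (\<integral>x. \<sigma> x * ((\<Sum>i\<in>UNIV. c $ i *\<^sub>R w i x) \<bullet> (\<Sum>i\<in>UNIV. c $ i *\<^sub>R w i x)) \<partial>lebesgue_on S)"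
    by (intro Bochner_Integration.integral_cong refl)
      (simp add: inner_sum_left inner_sum_right sum_distrib_left mult_ac inner_commute)
  also have "\<dots> \<ge> 0"
    by (intro Bochner_Integration.integral_nonneg mult_nonneg_nonneg nn) simp
  finally show "0 \<le> c \<bullet> (mass_matrix S \<sigma> w *v c)" .
qed

lemma transpose_mass_matrix: "transpose (mass_matrix S \<sigma> w) = mass_matrix S \<sigma> w"
  by (simp add: transpose_def mass_matrix_def inner_commute)

lemma transpose_curl_curl_matrix: "transpose (curl_curl_matrix S \<nu> w) = curl_curl_matrix S \<nu> w"
  by (simp add: transpose_def curl_curl_matrix_def inner_commute)

section \<open>Measurability of the piecewise constant conductivities\<close>

lemma conductivity_measurable:
  assumes "open A"
  shows "conductivity A \<sigma> \<in> borel_measurable lebesgue"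
proof -
  have [measurable]: "A \<in> sets lebesgue" using assms by (simp add: borel_open)
  have "(\<lambda>x. if x \<in> A then \<sigma> else 0) \<in> borel_measurable lebesgue" by measurable
  then show ?thesis by (simp add: conductivity_def[abs_def])
qed

lemma conductivity_str_measurable:
  assumes "open A" "\<And>k. open (B k)"
  shows "conductivity_str A \<sigma> B \<sigma>' \<in> borel_measurable lebesgue"
proof -
  have [measurable]: "(\<Union>k. B k) \<in> sets lebesgue" using assms(2) by (simp add: borel_open open_UN)
  have [measurable]: "conductivity A \<sigma> \<in> borel_measurable lebesgue"
    by (rule conductivity_measurable[OF assms(1)])
  have "(\<lambda>x. if x \<in> (\<Union>k. B k) then \<sigma>' else conductivity A \<sigma> x) \<in> borel_measurable lebesgue"
    by measurable
  then show ?thesis by (simp add: conductivity_str_def[abs_def])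
qed

section \<open>The Moore-Penrose pseudo-inverse of a symmetric matrix\<close>

lemma pseudo_inverse_unique:
  assumes P: "is_pseudo_inverse A P" and Q: "is_pseudo_inverse A Q"
  shows "P = Q"
proof -
  note p = P[unfolded is_pseudo_inverse_def] and q = Q[unfolded is_pseudo_inverse_def]
  \<comment> \<open>\<open>A Q A = A\<close> puts \<open>A Q\<close> in front of \<open>A P\<close>.
    Both are symmetric, so transposing swaps them, and \<open>A P A = A\<close> then absorbs
    \<open>A P\<close>.\<close>
  have "A ** P = A ** Q ** (A ** P)" using q by (simp add: matrix_mul_assoc)
  then have "transpose (A ** P) = transpose (A ** P) ** transpose (A ** Q)"
    by (metis matrix_transpose_mul)
  then have "A ** P = A ** P ** (A ** Q)" using p q by argo
  also have "\<dots> = A ** Q" using p by (simp add: matrix_mul_assoc)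
  finally have AP: "A ** P = A ** Q" .
  have "A ** (Q ** A) = A" "A ** (P ** A) = A" using p q by (simp_all add: matrix_mul_assoc)
  note assoc = this
  \<comment> \<open>The mirror image for the products with \<open>A\<close> on the right.\<close>
  have "P ** A = P ** A ** (Q ** A)" using assoc(1) by (simp flip: matrix_mul_assoc)
  then have "transpose (P ** A) = transpose (Q ** A) ** transpose (P ** A)"
    by (metis matrix_transpose_mul)
  then have "P ** A = Q ** A ** (P ** A)" using p q by argo
  also have "\<dots> = Q ** A" using assoc(2) by (simp flip: matrix_mul_assoc)
  finally have PA: "P ** A = Q ** A" .
  have "P = P ** A ** P" using p by simp
  also have "\<dots> = Q ** (A ** P)" using PA by (simp add: matrix_mul_assoc)
  also have "\<dots> = Q" using AP q by (simp add: matrix_mul_assoc)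
  finally show ?thesis .
qed

lemma transpose_zero: "transpose (0 :: 'a::zero^'n^'m) = 0"
  by (simp add: vec_eq_iff transpose_def)

lemma inner_matrix_vector_mult:
  fixes A :: "real^'n^'m"
  shows "x \<bullet> (A *v y) = (transpose A *v x) \<bullet> y"
  by (simp add: dot_lmul_matrix)

text \<open>The projection is the sum of \<open>(x \<bullet> b) b\<close> over an orthonormal basis
  of \<open>S\<close>.\<close>

lemma orthogonal_projection_matrix:
  fixes S :: "(real^'n) set"
  assumes "subspace S"
  obtains Q :: "real^'n^'n" where "transpose Q = Q" "\<And>x. Q *v x \<in> S" "\<And>x. x \<in> S \<Longrightarrow> Q *v x = x"
proof -
  obtain B where B: "B \<subseteq> S" "pairwise orthogonal B" "\<And>x. x \<in> B \<Longrightarrow> norm x = 1"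
    "independent B" "span B = S"
    using orthonormal_basis_subspace[OF assms] by metis
  have "finite B" using B(4) independent_bound by blast
  define f where "f = (\<lambda>x. \<Sum>b\<in>B. (x \<bullet> b) *\<^sub>R b)"
  have lin: "linear f"
    unfolding f_def by (intro linearI)
      (simp_all add: inner_add_left scaleR_add_left sum.distrib scaleR_sum_right)
  have fb: "f b = b" if "b \<in> B" for b
  proof -
    have "f b = (\<Sum>c\<in>B. if c = b then b else 0)"
      unfolding f_def
    proof (intro sum.cong refl)
      fix c assume "c \<in> B"
      show "(b \<bullet> c) *\<^sub>R c = (if c = b then b else 0)"
      proof (cases "c = b")
        case True
        then show ?thesis using B(3)[OF that] by (simp add: dot_square_norm)
      next
        case False
        then have "b \<bullet> c = 0"
          using B(2) that \<open>c \<in> B\<close> by (auto simp: pairwise_def orthogonal_def)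
        then show ?thesis using False by simp
      qed
    qed
    then show ?thesis using \<open>finite B\<close> that by simp
  qed
  have "f x = x" if "x \<in> S" for x
    using linear_eq_on_span[OF lin linear_id, of B x] fb that B(5) by simp
  moreover have "f x \<in> S" for x
    unfolding f_def using B(1) assms by (intro subspace_sum subspace_scale) auto
  \<comment> \<open>The entry at \<open>i\<close>, \<open>j\<close> is the sum of
    \<open>b $ i * b $ j\<close> over the basis, which is symmetric in \<open>i\<close> and
    \<open>j\<close>.\<close>
  moreover have "transpose (matrix f) = matrix f"
    by (simp add: vec_eq_iff transpose_def matrix_def f_def inner_axis' mult_ac)
  ultimately show thesis
    using that[of "matrix f"] lin by (simp add: matrix_works)
qed

text \<open>A symmetric \<open>A\<close> maps the orthogonal complement of its kernel bijectively to
  itself. Adding \<open>Q\<close> makes it the identity on the kernel, hence invertible; subtracting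
  \<open>Q\<close> from the inverse sends the kernel back to zero.\<close>

lemma symmetric_pseudo_inverse_exists:
  fixes A :: "real^'n^'n"
  assumes sym: "transpose A = A"
  shows "\<exists>P. is_pseudo_inverse A P"
proof -
  have sub: "subspace {x. A *v x = 0}"
    by (auto simp: subspace_def matrix_vector_right_distrib matrix_vector_mult_scaleR)
  obtain Q :: "real^'n^'n" where Q: "transpose Q = Q" "\<And>x. A *v (Q *v x) = 0"
    "\<And>x. A *v x = 0 \<Longrightarrow> Q *v x = x"
  proof (rule orthogonal_projection_matrix[OF sub])
    fix Q :: "real^'n^'n"
    assume "transpose Q = Q" "\<And>x. Q *v x \<in> {x. A *v x = 0}"
      "\<And>x. x \<in> {x. A *v x = 0} \<Longrightarrow> Q *v x = x"
    then show thesis using that[of Q] by simp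
  qed
  have AQ: "A ** Q = 0"
    by (simp add: matrix_eq Q(2) flip: matrix_vector_mul_assoc)
  then have QA: "Q ** A = 0"
    by (metis Q(1) sym matrix_transpose_mul transpose_zero)
  have QQ: "Q ** Q = Q"
    by (simp add: matrix_eq Q flip: matrix_vector_mul_assoc)
  have addr: "(U + V) ** W = U ** W + V ** W" for U V W :: "real^'n^'n"
    by (simp add: vec_eq_iff matrix_matrix_mult_def algebra_simps sum.distrib)
  have QN: "Q ** (A + Q) = Q" by (simp add: matrix_add_ldistrib QA QQ)
  have NQ: "(A + Q) ** Q = Q" by (simp add: addr AQ QQ)
  \<comment> \<open>Applying \<open>Q\<close> leaves \<open>Q x = 0\<close>. Then
    \<open>A x = 0\<close> as well, so \<open>x\<close> lies in the kernel, where \<open>Q\<close>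
    is the identity: \<open>x = Q x = 0\<close>.\<close>
  have "x = 0" if "(A + Q) *v x = 0" for x
  proof -
    have "Q *v x = Q *v ((A + Q) *v x)"
      by (simp add: matrix_vector_mul_assoc QN)
    then have "Q *v x = 0" using that by simp
    then show ?thesis using that Q(3)[of x] by (simp add: matrix_vector_mult_add_rdistrib)
  qed
  then obtain N where NL: "N ** (A + Q) = mat 1"
    using matrix_left_invertible_ker by blast
  then have NR: "(A + Q) ** N = mat 1" using matrix_left_right_inverse by blast
  \<comment> \<open>\<open>A + Q\<close> fixes \<open>Q\<close> from either side, and so does its
    inverse \<open>N\<close>.\<close>
  have NQ': "N ** Q = Q" by (metis NL NQ matrix_mul_assoc matrix_mul_lid)
  have QN': "Q ** N = Q" by (metis NR QN matrix_mul_assoc matrix_mul_rid)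
  have NA: "N ** A = mat 1 - Q" using NL NQ' by (simp add: matrix_add_ldistrib eq_diff_eq)
  have AN: "A ** N = mat 1 - Q" using NR QN' by (simp add: addr eq_diff_eq)
  have diffl: "(U - V) ** W = U ** W - V ** W" and diffr: "W ** (U - V) = W ** U - W ** V"
    for U V W :: "real^'n^'n"
    by (simp_all add: vec_eq_iff matrix_matrix_mult_def algebra_simps sum_subtractf)
  have trd: "transpose (mat 1 - Q) = mat 1 - Q"
    using Q(1) by (simp add: vec_eq_iff transpose_def mat_def)
  \<comment> \<open>Both products of \<open>A\<close> with \<open>N - Q\<close> are the
    complementary projection \<open>mat 1 - Q\<close>, which is symmetric and acts as the identity
    on \<open>A\<close> and on \<open>N - Q\<close>.\<close>
  have "is_pseudo_inverse A (N - Q)"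
    unfolding is_pseudo_inverse_def
    by (simp add: diffl diffr AQ QA AN NA trd QN' QQ)
  then show ?thesis ..
qed

lemma pseudo_inverse_symmetric_positive_semidefinite:
  fixes A :: "real^'n^'n"
  assumes sym: "transpose A = A" and psd: "positive_semidefinite A"
  shows "transpose (pseudo_inverse A) = pseudo_inverse A" "positive_semidefinite (pseudo_inverse A)"
proof -
  define P where "P = pseudo_inverse A"
  \<comment> \<open>Existence and uniqueness give the definite description its meaning.\<close>
  have P: "is_pseudo_inverse A P"
    unfolding P_def pseudo_inverse_def
    using symmetric_pseudo_inverse_exists[OF sym] pseudo_inverse_unique by (metis theI)
  then have p: "A ** P ** A = A" "P ** A ** P = P"
    "transpose (A ** P) = A ** P" "transpose (P ** A) = P ** A"
    by (auto simp: is_pseudo_inverse_def)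
  \<comment> \<open>Transposition permutes the Penrose conditions of a symmetric \<open>A\<close>,
    so uniqueness forces \<open>P\<close> to be symmetric.\<close>
  have "is_pseudo_inverse A (transpose P)"
    unfolding is_pseudo_inverse_def
    using p sym by (metis matrix_mul_assoc matrix_transpose_mul transpose_transpose)
  then have tP: "transpose P = P" using P by (rule pseudo_inverse_unique)
  have "x \<bullet> (P *v x) \<ge> 0" for x
  proof -
    have "x \<bullet> (P *v x) = x \<bullet> (P *v (A *v (P *v x)))"
      by (simp add: matrix_vector_mul_assoc p matrix_mul_assoc)
    also have "\<dots> = (P *v x) \<bullet> (A *v (P *v x))"
      by (metis tP inner_matrix_vector_mult)
    finally show ?thesis using psd by (simp add: positive_semidefinite_def)
  qed
  then show "transpose (pseudo_inverse A) = pseudo_inverse A"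
      "positive_semidefinite (pseudo_inverse A)"
    using tP by (simp_all add: positive_semidefinite_def P_def)
qed

text \<open>A congruence by \<open>X\<close> keeps symmetry, and its quadratic form at
  \<open>x\<close> is that of the pseudo-inverse at \<open>X x\<close>.\<close>

lemma resistance_matrix_symmetric_positive_semidefinite:
  assumes "transpose A = A" "positive_semidefinite A"
  shows "transpose (resistance_matrix X A) = resistance_matrix X A"
    "positive_semidefinite (resistance_matrix X A)"
proof -
  note P = pseudo_inverse_symmetric_positive_semidefinite[OF assms]
  show "transpose (resistance_matrix X A) = resistance_matrix X A"
    by (simp add: resistance_matrix_def matrix_transpose_mul P(1) matrix_mul_assoc)
  have "x \<bullet> (resistance_matrix X A *v x) = (X *v x) \<bullet> (pseudo_inverse A *v (X *v x))" for x
    unfolding resistance_matrix_def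
    by (metis inner_matrix_vector_mult matrix_vector_mul_assoc transpose_transpose)
  then show "positive_semidefinite (resistance_matrix X A)"
    using P(2) by (simp add: positive_semidefinite_def)
qed


subsection \<open>Block matrices and the quadratic Hamiltonian\<close>

text \<open>The usual two by two block matrix with rows \<open>A\<close>, \<open>B\<close> and
  \<open>C\<close>, \<open>D\<close>; in the application \<open>Inl\<close> indexes \<open>a\<close>
  and \<open>Inr\<close> indexes the currents.\<close>

definition block_matrix ::
    "real^'w^'w \<Rightarrow> real^'s^'w \<Rightarrow> real^'w^'s \<Rightarrow> real^'s^'s \<Rightarrow> real^('w::finite + 's::finite)^('w + 's)" where
  "block_matrix A B C D = (\<chi> i j. case i of
      Inl i' \<Rightarrow> (case j of Inl j' \<Rightarrow> A $ i' $ j' | Inr j' \<Rightarrow> B $ i' $ j')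
    | Inr i' \<Rightarrow> (case j of Inl j' \<Rightarrow> C $ i' $ j' | Inr j' \<Rightarrow> D $ i' $ j'))"

lemma sum_UNIV_Plus:
  "(\<Sum>i\<in>(UNIV :: ('a::finite + 'b::finite) set). f i) = (\<Sum>i\<in>UNIV. f (Inl i)) + (\<Sum>i\<in>UNIV. f (Inr i))"
  by (subst UNIV_Plus_UNIV[symmetric], subst sum.Plus) auto

text \<open>This splits the structured system into the two equations of the model.\<close>

lemma parts_eq_iff: "z = z' \<longleftrightarrow> inl_part z = inl_part z' \<and> inr_part z = inr_part z'"
  by (auto simp: vec_eq_iff inl_part_def inr_part_def) (metis sumE)

lemma parts_block_matrix_mult:
  "inl_part (block_matrix A B C D *v z) = A *v inl_part z + B *v inr_part z"
  "inr_part (block_matrix A B C D *v z) = C *v inl_part z + D *v inr_part z"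
  by (simp_all add: vec_eq_iff inl_part_def inr_part_def matrix_vector_mult_def sum_UNIV_Plus
      block_matrix_def)

lemma transpose_block_matrix:
  "transpose (block_matrix A B C D) =
    block_matrix (transpose A) (transpose C) (transpose B) (transpose D)"
  by (auto simp: vec_eq_iff transpose_def block_matrix_def split: sum.splits)

lemma block_matrix_diff:
  "block_matrix A B C D - block_matrix A' B' C' D' = block_matrix (A - A') (B - B') (C - C') (D - D')"
  by (auto simp: vec_eq_iff block_matrix_def split: sum.splits)

lemma block_matrix_uminus: "- block_matrix A B C D = block_matrix (- A) (- B) (- C) (- D)"
  by (auto simp: vec_eq_iff block_matrix_def split: sum.splits)

lemma inner_parts: "z \<bullet> z' = inl_part z \<bullet> inl_part z' + inr_part z \<bullet> inr_part z'"
  by (simp add: inner_vec_def sum_UNIV_Plus inl_part_def inr_part_def)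

lemma block_diagonal_positive_semidefinite:
  assumes "positive_semidefinite A" "positive_semidefinite D"
  shows "positive_semidefinite (block_matrix A 0 0 D)"
  using assms by (simp add: positive_semidefinite_def inner_parts parts_block_matrix_mult)

section \<open>The gradient of the Hamiltonian and coordinatewise derivatives\<close>

lemma gderiv_quadratic_form:
  fixes A :: "real^'n^'n"
  assumes "transpose A = A"
  shows "GDERIV (\<lambda>z. (1/2) * (z \<bullet> (A *v z))) z :> A *v z"
proof -
  \<comment> \<open>The product rule yields two terms; symmetry makes them equal, which cancels the
    factor \<open>1/2\<close>.\<close>
  have sym: "z \<bullet> (A *v h) = h \<bullet> (A *v z)" for h
    using inner_matrix_vector_mult[of z A h] assms by (simp only: inner_commute)
  have "((\<lambda>z. z \<bullet> (A *v z)) has_derivative (\<lambda>h. z \<bullet> (A *v h) + h \<bullet> (A *v z))) (at z)"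
    by (rule has_derivative_inner[OF has_derivative_ident
          bounded_linear.has_derivative[OF matrix_vector_mul_bounded_linear has_derivative_ident]])
  then have "((\<lambda>z. (1/2) * (z \<bullet> (A *v z))) has_derivative
      (\<lambda>h. (1/2) * (z \<bullet> (A *v h) + h \<bullet> (A *v z)))) (at z)"
    by (rule has_derivative_mult_right)
  then show ?thesis
    unfolding gderiv_def sym by simp
qed

text \<open>The model differentiates vectors, the structured system single coordinates; this
  translates between them.\<close>

lemma has_vector_derivative_vec_iff:
  fixes f :: "real \<Rightarrow> real^'n"
  shows "(f has_vector_derivative f') (at t within T) \<longleftrightarrow>
    (\<forall>i. ((\<lambda>s. f s $ i) has_real_derivative f' $ i) (at t within T))"
proof -
  have "(f has_vector_derivative f') (at t within T) \<longleftrightarrow>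
      (\<forall>b\<in>Basis. ((\<lambda>s. f s \<bullet> b) has_vector_derivative f' \<bullet> b) (at t within T))"
    unfolding has_vector_derivative_def
    by (subst has_derivative_componentwise_within) simp
  also have "\<dots> \<longleftrightarrow> (\<forall>i. ((\<lambda>s. f s $ i) has_real_derivative f' $ i) (at t within T))"
    by (auto simp: Basis_vec_def inner_axis has_real_derivative_iff_has_vector_derivative)
  finally show ?thesis .
qed

text \<open>The linear-algebraic core: symmetry of \<open>K\<close> makes \<open>K a\<close> a
  gradient, while \<open>M\<close> and \<open>R\<close> supply the dissipation.\<close>

lemma fits_structure_block_model:
  fixes M K :: "real^'w::finite^'w" and X :: "real^'s::finite^'w" and R :: "real^'s^'s"
  assumes M: "transpose M = M" "positive_semidefinite M"
    and K: "transpose K = K"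
    and R: "transpose R = R" "positive_semidefinite R"
  shows "fits_structure T
    (\<lambda>(z :: real \<Rightarrow> real^('w + 's)) (v :: real \<Rightarrow> real^'s) t.
      stranded_model_at M K X R T (\<lambda>s. inl_part (z s)) (\<lambda>s. inr_part (z s)) v t)"
proof -
  define grp :: "'w + 's \<Rightarrow> component" where "grp = case_sum (\<lambda>_. Z1) (\<lambda>_. Z3)"
  define KB :: "real^('w + 's)^('w + 's)" where "KB = block_matrix K 0 0 0"
  define J where "J = block_matrix 0 X (- transpose X) 0"
  define RB :: "real^('w + 's)^('w + 's)" where "RB = block_matrix M 0 0 R"
  \<comment> \<open>The block column of zero and identity: the voltage enters the second
    equation.\<close>
  define B :: "real^'s^('w + 's)" where "B = (\<chi> i k. case i of Inl _ \<Rightarrow> 0 | Inr j \<Rightarrow> mat 1 $ j $ k)"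
  define H where "H = (\<lambda>z. (1/2) * (z \<bullet> (KB *v z)))"
  have tr_uminus: "transpose (- A) = - transpose A" for A :: "real^'w^'s"
    by (simp add: vec_eq_iff transpose_def)
  have "C1_hamiltonian grp H ((*v) KB)"
    unfolding C1_hamiltonian_def
  proof (intro conjI allI impI)
    fix z z' :: "real^('w + 's)" assume "\<forall>i. grp i \<noteq> Z3 \<longrightarrow> z $ i = z' $ i"
    \<comment> \<open>The coordinates outside \<open>Z3\<close> are those of \<open>a\<close>, and
      the single nonzero block \<open>K\<close> of \<open>KB\<close> sees no others.\<close>
    then have "inl_part z = inl_part z'"
      by (auto simp: inl_part_def vec_eq_iff grp_def split: sum.splits)
    then show "H z = H z'"
      by (simp add: H_def KB_def inner_parts parts_block_matrix_mult)
  next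
    show "GDERIV H z :> KB *v z" for z
      unfolding H_def by (rule gderiv_quadratic_form) (simp add: KB_def transpose_block_matrix transpose_zero K)
    show "continuous_on UNIV ((*v) KB)"
      by (intro linear_continuous_on matrix_vector_mul_bounded_linear)
  qed
  moreover have "J = - transpose J"
    by (simp add: J_def transpose_block_matrix block_matrix_uminus transpose_zero tr_uminus)
  moreover have "RB = transpose RB"
    by (simp add: RB_def transpose_block_matrix transpose_zero M R)
  moreover have "positive_semidefinite RB"
    unfolding RB_def by (rule block_diagonal_positive_semidefinite[OF M(2) R(2)])
  moreover have "stranded_model_at M K X R T (\<lambda>s. inl_part (z s)) (\<lambda>s. inr_part (z s)) v t
      \<longleftrightarrow> structured_system_at grp ((*v) KB) J RB B T z v t" for z v t
  proof -
    have BP: "inl_part (B *v u) = 0" "inr_part (B *v u) = u" for u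
    proof -
      show "inl_part (B *v u) = 0"
        by (simp add: vec_eq_iff inl_part_def B_def matrix_vector_mult_def)
      have "inr_part (B *v u) = mat 1 *v u"
        by (simp add: vec_eq_iff inr_part_def B_def matrix_vector_mult_def)
      then show "inr_part (B *v u) = u" by simp
    qed
    have add: "inl_part (x + y) = inl_part x + inl_part y" "inr_part (x + y) = inr_part x + inr_part y"
      for x y :: "real^('w + 's)"
      by (simp_all add: vec_eq_iff inl_part_def inr_part_def)
    have neg: "(- A) *v x = - (A *v x)" for A :: "real^'p^'q" and x
      by (simp add: vec_eq_iff matrix_vector_mult_def sum_negf)
    \<comment> \<open>For fixed \<open>dz\<close> the left side stacks \<open>K a\<close> over zero,
      and \<open>J - RB\<close> acts on \<open>a'\<close> stacked over the currents. The two blocks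
      are the model equations up to moving terms.\<close>
    have eqs: "(\<chi> i. case grp i of Z1 \<Rightarrow> (KB *v z t) $ i | Z2 \<Rightarrow> dz $ i | Z3 \<Rightarrow> 0) =
        (J - RB) *v (\<chi> i. case grp i of Z1 \<Rightarrow> dz $ i | Z2 \<Rightarrow> (KB *v z t) $ i | Z3 \<Rightarrow> z t $ i) + B *v v t
      \<longleftrightarrow> M *v inl_part dz + K *v inl_part (z t) - X *v inr_part (z t) = 0 \<and>
        transpose X *v inl_part dz + R *v inr_part (z t) - v t = 0" for dz
    proof -
      have l: "inl_part (\<chi> i. case grp i of Z1 \<Rightarrow> (KB *v z t) $ i | Z2 \<Rightarrow> dz $ i | Z3 \<Rightarrow> 0) = K *v inl_part (z t)"
        "inr_part (\<chi> i. case grp i of Z1 \<Rightarrow> (KB *v z t) $ i | Z2 \<Rightarrow> dz $ i | Z3 \<Rightarrow> 0) = 0"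
        using parts_block_matrix_mult(1)[of K 0 0 0 "z t"]
        by (simp_all add: vec_eq_iff inl_part_def inr_part_def grp_def KB_def)
      have r: "inl_part (\<chi> i. case grp i of Z1 \<Rightarrow> dz $ i | Z2 \<Rightarrow> (KB *v z t) $ i | Z3 \<Rightarrow> z t $ i) = inl_part dz"
        "inr_part (\<chi> i. case grp i of Z1 \<Rightarrow> dz $ i | Z2 \<Rightarrow> (KB *v z t) $ i | Z3 \<Rightarrow> z t $ i) = inr_part (z t)"
        by (simp_all add: vec_eq_iff inl_part_def inr_part_def grp_def)
      show ?thesis
        unfolding parts_eq_iff[of "vec_lambda _"] add BP J_def RB_def block_matrix_diff
          parts_block_matrix_mult l r
        by (auto simp: neg algebra_simps)
    qed
    have der: "(\<forall>i. grp i \<noteq> Z3 \<longrightarrow> ((\<lambda>s. z s $ i) has_real_derivative dz $ i) (at t within T))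
      \<longleftrightarrow> ((\<lambda>s. inl_part (z s)) has_vector_derivative inl_part dz) (at t within T)" for dz
      unfolding has_vector_derivative_vec_iff
      by (auto simp: inl_part_def grp_def split: sum.splits)
    \<comment> \<open>The model asks for a derivative of \<open>a\<close>, the structured system for
      a whole \<open>dz\<close>. Just the \<open>a\<close>-block of \<open>dz\<close> matters, so
      padding with zeros matches the two existential quantifiers.\<close>
    have surj: "\<exists>dz :: real^('w + 's). inl_part dz = da" for da
      by (intro exI[of _ "\<chi> i. case i of Inl j \<Rightarrow> da $ j | Inr _ \<Rightarrow> 0"]) (simp add: inl_part_def vec_eq_iff)
    show ?thesis
      unfolding stranded_model_at_def structured_system_at_def eqs der using surj by metis
  qed
  ultimately show ?thesis
    unfolding fits_structure_def by blast
qed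

section \<open>Application to the finite element matrices\<close>

theorem theorem11:
  fixes \<Omega> \<Omega>c :: "(real^3) set"
    and w :: "'w::finite \<Rightarrow> real^3 \<Rightarrow> real^3"
    and \<nu> \<sigma>c \<sigma>str :: real
    and \<Omega>str :: "'s::finite \<Rightarrow> (real^3) set"
    and wind :: "'s \<Rightarrow> real^3 \<Rightarrow> real^3"
    and t0 tf :: real
    and M K Mstr :: "real^'w^'w" and X :: "real^'s^'w" and R :: "real^'s^'s"
  assumes "lipschitz_domain \<Omega>" and "simply_connected \<Omega>"
    and "\<And>i. w i \<in> Hcurl \<Omega>" and "\<And>i. vanishing_tangential_trace \<Omega> (w i)"
    and "lin_indep_ae \<Omega> w"
    and "\<nu> > 0"
    and "subdomain \<Omega>c \<Omega>" and "\<sigma>c > 0"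
    and "\<And>k. subdomain (\<Omega>str k) \<Omega>" and "disjoint_family \<Omega>str"
    and "\<And>k. \<Omega>str k \<inter> \<Omega>c = {}" and "\<sigma>str > 0"
    and "\<And>i k. integrable (lebesgue_on \<Omega>) (\<lambda>x. zero_extension (\<Omega>str k) (wind k) x \<bullet> w i x)"
    and "M = mass_matrix \<Omega> (conductivity \<Omega>c \<sigma>c) w"
    and "K = curl_curl_matrix \<Omega> \<nu> w"
    and "regular_pencil M K"
    and "X = winding_matrix \<Omega> \<Omega>str wind w"
    and "Mstr = mass_matrix \<Omega> (conductivity_str \<Omega>c \<sigma>c \<Omega>str \<sigma>str) w"
    and "R = resistance_matrix X Mstr"
    and "t0 < tf"
  shows "fits_structure {t0..tf}
    (\<lambda>(z :: real \<Rightarrow> real^('w + 's)) (vstr :: real \<Rightarrow> real^'s) t.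
      stranded_model_at M K X R {t0..tf} (\<lambda>s. inl_part (z s)) (\<lambda>s. inr_part (z s)) vstr t)"
proof -
  have sq: "square_integrable \<Omega> (w i)" for i
    using assms(3) by (simp add: Hcurl_def)
  have op: "open \<Omega>c" "open (\<Omega>str k)" for k
    using assms(7,9) by (auto simp: subdomain_def domain_set_def)
  have "positive_semidefinite M"
    unfolding assms(14) using assms(8)
    by (intro mass_matrix_positive_semidefinite[where C = \<sigma>c] sq measurable_restrict_space1
        conductivity_measurable op) (auto simp: conductivity_def)
  \<comment> \<open>The modified conductivity takes values among \<open>\<sigma>str\<close>,
    \<open>\<sigma>c\<close> and zero, so the sum of the two positive constants bounds it.\<close>
  moreover have "positive_semidefinite Mstr"
    unfolding assms(18) using assms(8,12)
    by (intro mass_matrix_positive_semidefinite[where C = "\<sigma>c + \<sigma>str"] sq measurable_restrict_space1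
        conductivity_str_measurable op) (auto simp: conductivity_str_def conductivity_def)
  ultimately show ?thesis
    using assms(14,15,18,19)
    by (intro fits_structure_block_model)
      (simp_all add: transpose_mass_matrix transpose_curl_curl_matrix
        resistance_matrix_symmetric_positive_semidefinite)
qed

end
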